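(* Let $(M,P,g)$ be a Riemannian $\mathcal{W}_3$-manifold with zero tensor $L$. Then for all smooth vector fields $x,y,z,w$ on $M$, $$\begin{aligned}&2\bigl(R(x,y,z,w)+R(x,Py,Pz,w)+R(Px,Py,z,w)+R(Px,y,Pz,w)\bigr)\\&\quad=2g\bigl((\nabla_yP)Px+(\nabla_{Py}P)x,\ (\nabla_{Pw}P)z\bigr)\\&\qquad+g\bigl((\nabla_yP)Pz+(\nabla_{Py}P)z,\ (\nabla_{Pw}P)x\bigr)\\&\qquad+g\bigl((\nabla_zP)Px+(\nabla_{Pz}P)x,\ (\nabla_{Pw}P)y\bigr).\end{aligned}$$
   Context: A Riemannian almost product manifold $(M,P,g)$ is a smooth manifold $M$ with a $(1,1)$-tensor field $P$ and a Riemannian metric $g$ such that $P^2x=x$ and $g(Px,Py)=g(x,y)$ for all smooth vector fields $x,y$; it is assumed throughout that $\mathrm{tr}\,P=0$ (so $\dim M$ is even). Let $\nabla$ be the Levi-Civita connection of $g$ and $F(x,y,z)=g((\nabla_xP)y,z)$. A Riemannian $\mathcal{W}_3$-manifold is a Riemannian almost product manifold (with $\mathrm{tr}\,P=0$) satisfying $F(x,y,z)+F(y,z,x)+F(z,x,y)=0$ for all $x,y,z$. The curvature tensor is $R(x,y)z=\nabla_x\nabla_yz-\nabla_y\nabla_xz-\nabla_{[x,y]}z$ and $R(x,y,z,w)=g(R(x,y)z,w)$. The tensor $L$ is $L(x,y)z=R(x,y)z+\tfrac12Q(x,y)z$, where $$T(x,y)=-(\nabla_xP)Py-(\nabla_yP)Px,$$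 $$Q(x,y)z=(\nabla_xT)(y,z)-(\nabla_yT)(x,z)+T(x,T(y,z))-T(y,T(x,z)).$$ *)

theory Defs
  imports "HOL-Analysis.Analysis" "HOL-Library.Function_Algebras"
begin

text \<open>
  Functions carry the pointwise operations of \<open>Function_Algebras\<close>, so \<open>+\<close>, \<open>-\<close>, \<open>0\<close> are the
  usual operations on real-valued functions, tangent vectors and vector fields.
\<close>

section \<open>Smooth manifolds\<close>

text \<open>Only meant for open \<open>S\<close>: derivatives of order \<open>Suc k\<close> are taken direction by direction.\<close>

fun Ck_on :: "nat \<Rightarrow> ('a::euclidean_space \<Rightarrow> 'b::real_normed_vector) \<Rightarrow> 'a set \<Rightarrow> bool" where
  "Ck_on 0 f S \<longleftrightarrow> continuous_on S f"
| "Ck_on (Suc k) f S \<longleftrightarrow>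
     (\<forall>x\<in>S. f differentiable (at x)) \<and> (\<forall>v. Ck_on k (\<lambda>x. frechet_derivative f (at x) v) S)"

definition smooth_on :: "('a::euclidean_space \<Rightarrow> 'b::real_normed_vector) \<Rightarrow> 'a set \<Rightarrow> bool" where
  "smooth_on f S \<longleftrightarrow> (\<forall>k. Ck_on k f S)"

text \<open>
  Charts take values in a Euclidean space \<open>'e\<close>, so the dimension is \<open>DIM('e)\<close>. The atlas need
  not be maximal.
\<close>

type_synonym ('m, 'e) chart = "'m set \<times> ('m \<Rightarrow> 'e)"

definition is_chart :: "'m topology \<Rightarrow> ('m, 'e::euclidean_space) chart \<Rightarrow> bool" where
  "is_chart M c \<longleftrightarrow> (case c of (U, \<phi>) \<Rightarrow>
     openin M U \<and> open (\<phi> ` U) \<and>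
     homeomorphic_map (subtopology M U) (top_of_set (\<phi> ` U)) \<phi>)"

definition smooth_manifold :: "'m topology \<Rightarrow> ('m, 'e::euclidean_space) chart set \<Rightarrow> bool" where
  "smooth_manifold M \<A> \<longleftrightarrow>
     Hausdorff_space M \<and> second_countable M \<and>
     (\<forall>c\<in>\<A>. is_chart M c) \<and>
     (\<Union>(U, \<phi>)\<in>\<A>. U) = topspace M \<and>
     (\<forall>(U, \<phi>)\<in>\<A>. \<forall>(V, \<psi>)\<in>\<A>. smooth_on (\<psi> \<circ> inv_into U \<phi>) (\<phi> ` (U \<inter> V)))"

text \<open>The values of a function outside \<open>topspace M\<close> are irrelevant and left unconstrained.\<close>

definition smooth_fun :: "('m, 'e::euclidean_space) chart set \<Rightarrow> ('m \<Rightarrow> real) \<Rightarrow> bool" where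
  "smooth_fun \<A> f \<longleftrightarrow> (\<forall>(U, \<phi>)\<in>\<A>. smooth_on (f \<circ> inv_into U \<phi>) (\<phi> ` U))"


section \<open>Tangent vectors and vector fields\<close>

type_synonym 'm tvec = "('m \<Rightarrow> real) \<Rightarrow> real"
type_synonym 'm vfield = "'m \<Rightarrow> 'm tvec"

text \<open>
  Tangent vectors are derivations at \<open>p\<close> of the algebra of smooth functions. The value \<open>0\<close> on
  non-smooth arguments only serves to represent each derivation by a unique HOL function. The
  Leibniz rule already makes \<open>v f\<close> independent of \<open>f\<close> outside the manifold: if \<open>f\<close> vanishes on
  the manifold, then \<open>f = f * indicator (- topspace M)\<close> and hence \<open>v f = 0\<close>.
\<close>

definition tangent_space :: "('m, 'e::euclidean_space) chart set \<Rightarrow> 'm \<Rightarrow> 'm tvec set" where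
  "tangent_space \<A> p = {v.
     (\<forall>f h. smooth_fun \<A> f \<longrightarrow> smooth_fun \<A> h \<longrightarrow> v (f + h) = v f + v h) \<and>
     (\<forall>a f. smooth_fun \<A> f \<longrightarrow> v (\<lambda>q. a * f q) = a * v f) \<and>
     (\<forall>f h. smooth_fun \<A> f \<longrightarrow> smooth_fun \<A> h \<longrightarrow> v (f * h) = f p * v h + h p * v f) \<and>
     (\<forall>f. \<not> smooth_fun \<A> f \<longrightarrow> v f = 0)}"

definition tscale :: "real \<Rightarrow> 'm tvec \<Rightarrow> 'm tvec" where
  "tscale a v = (\<lambda>f. a * v f)"

interpretation tvec: vector_space tscale
  by standard (auto simp: tscale_def fun_eq_iff algebra_simps)

definition vapply :: "'m vfield \<Rightarrow> ('m \<Rightarrow> real) \<Rightarrow> ('m \<Rightarrow> real)" where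
  "vapply X f = (\<lambda>p. X p f)"

definition vscale :: "('m \<Rightarrow> real) \<Rightarrow> 'm vfield \<Rightarrow> 'm vfield" where
  "vscale f X = (\<lambda>p. tscale (f p) (X p))"

text \<open>Smooth vector fields; they are set to \<open>0\<close> outside \<open>topspace M\<close> to make them unique.\<close>

definition vector_fields ::
  "'m topology \<Rightarrow> ('m, 'e::euclidean_space) chart set \<Rightarrow> 'm vfield set" where
  "vector_fields M \<A> = {X.
     (\<forall>p\<in>topspace M. X p \<in> tangent_space \<A> p) \<and>
     (\<forall>p. p \<notin> topspace M \<longrightarrow> X p = 0) \<and>
     (\<forall>f. smooth_fun \<A> f \<longrightarrow> smooth_fun \<A> (vapply X f))}"

definition lie_bracket ::
  "('m, 'e::euclidean_space) chart set \<Rightarrow> 'm vfield \<Rightarrow> 'm vfield \<Rightarrow> 'm vfield" where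
  "lie_bracket \<A> X Y = (\<lambda>p f.
     if smooth_fun \<A> f then X p (vapply Y f) - Y p (vapply X f) else 0)"


section \<open>Tensor fields of type (1,1), metrics, Levi-Civita connection\<close>

type_synonym 'm endo = "'m \<Rightarrow> 'm tvec \<Rightarrow> 'm tvec"
type_synonym 'm metric = "'m \<Rightarrow> 'm tvec \<Rightarrow> 'm tvec \<Rightarrow> real"
type_synonym 'm connection = "'m vfield \<Rightarrow> 'm vfield \<Rightarrow> 'm vfield"

definition eapply :: "'m topology \<Rightarrow> 'm endo \<Rightarrow> 'm vfield \<Rightarrow> 'm vfield" where
  "eapply M P X = (\<lambda>p. if p \<in> topspace M then P p (X p) else 0)"

definition endo_field ::
  "'m topology \<Rightarrow> ('m, 'e::euclidean_space) chart set \<Rightarrow> 'm endo \<Rightarrow> bool" where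
  "endo_field M \<A> P \<longleftrightarrow>
     (\<forall>p\<in>topspace M.
        (\<forall>v\<in>tangent_space \<A> p. P p v \<in> tangent_space \<A> p) \<and>
        (\<forall>u\<in>tangent_space \<A> p. \<forall>v\<in>tangent_space \<A> p. P p (u + v) = P p u + P p v) \<and>
        (\<forall>a. \<forall>v\<in>tangent_space \<A> p. P p (tscale a v) = tscale a (P p v))) \<and>
     (\<forall>X\<in>vector_fields M \<A>. eapply M P X \<in> vector_fields M \<A>)"

text \<open>The trace of an endomorphism \<open>A\<close> of a finite-dimensional space \<open>V\<close> of tangent vectors.\<close>

definition trace_on :: "'m tvec set \<Rightarrow> ('m tvec \<Rightarrow> 'm tvec) \<Rightarrow> real" where
  "trace_on V A =
     (let B = (SOME B. tvec.independent B \<and> tvec.span B = V)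
      in \<Sum>b\<in>B. tvec.representation B (A b) b)"

definition metric_fun :: "'m metric \<Rightarrow> 'm vfield \<Rightarrow> 'm vfield \<Rightarrow> 'm \<Rightarrow> real" where
  "metric_fun g X Y = (\<lambda>p. g p (X p) (Y p))"

definition riemannian_metric ::
  "'m topology \<Rightarrow> ('m, 'e::euclidean_space) chart set \<Rightarrow> 'm metric \<Rightarrow> bool" where
  "riemannian_metric M \<A> g \<longleftrightarrow>
     (\<forall>p\<in>topspace M.
        (\<forall>u\<in>tangent_space \<A> p. \<forall>v\<in>tangent_space \<A> p. g p u v = g p v u) \<and>
        (\<forall>u\<in>tangent_space \<A> p. \<forall>v\<in>tangent_space \<A> p. \<forall>w\<in>tangent_space \<A> p.
           g p (u + v) w = g p u w + g p v w) \<and>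
        (\<forall>a. \<forall>u\<in>tangent_space \<A> p. \<forall>v\<in>tangent_space \<A> p. g p (tscale a u) v = a * g p u v) \<and>
        (\<forall>v\<in>tangent_space \<A> p. v \<noteq> 0 \<longrightarrow> g p v v > 0)) \<and>
     (\<forall>X\<in>vector_fields M \<A>. \<forall>Y\<in>vector_fields M \<A>. smooth_fun \<A> (metric_fun g X Y))"

definition affine_connection ::
  "'m topology \<Rightarrow> ('m, 'e::euclidean_space) chart set \<Rightarrow> 'm connection \<Rightarrow> bool" where
  "affine_connection M \<A> D \<longleftrightarrow>
     (\<forall>X\<in>vector_fields M \<A>. \<forall>Y\<in>vector_fields M \<A>.
        D X Y \<in> vector_fields M \<A> \<and>
        (\<forall>Z\<in>vector_fields M \<A>. D (X + Y) Z = D X Z + D Y Z \<and> D X (Y + Z) = D X Y + D X Z) \<and>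
        (\<forall>f. smooth_fun \<A> f \<longrightarrow>
           D (vscale f X) Y = vscale f (D X Y) \<and>
           D X (vscale f Y) = vscale (vapply X f) Y + vscale f (D X Y)))"

definition levi_civita ::
  "'m topology \<Rightarrow> ('m, 'e::euclidean_space) chart set \<Rightarrow> 'm metric \<Rightarrow> 'm connection \<Rightarrow> bool" where
  "levi_civita M \<A> g D \<longleftrightarrow>
     affine_connection M \<A> D \<and>
     (\<forall>X\<in>vector_fields M \<A>. \<forall>Y\<in>vector_fields M \<A>.
        D X Y - D Y X = lie_bracket \<A> X Y \<and>
        (\<forall>Z\<in>vector_fields M \<A>. \<forall>p\<in>topspace M.
           vapply X (metric_fun g Y Z) p = metric_fun g (D X Y) Z p + metric_fun g Y (D X Z) p))"

definition curvature ::
  "('m, 'e::euclidean_space) chart set \<Rightarrow> 'm connection \<Rightarrow>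
   'm vfield \<Rightarrow> 'm vfield \<Rightarrow> 'm vfield \<Rightarrow> 'm vfield" where
  "curvature \<A> D x y z = D x (D y z) - D y (D x z) - D (lie_bracket \<A> x y) z"

definition curvature4 ::
  "('m, 'e::euclidean_space) chart set \<Rightarrow> 'm metric \<Rightarrow> 'm connection \<Rightarrow>
   'm vfield \<Rightarrow> 'm vfield \<Rightarrow> 'm vfield \<Rightarrow> 'm vfield \<Rightarrow> 'm \<Rightarrow> real" where
  "curvature4 \<A> g D x y z w = metric_fun g (curvature \<A> D x y z) w"


section \<open>Riemannian almost product manifolds\<close>

definition riemannian_almost_product ::
  "'m topology \<Rightarrow> ('m, 'e::euclidean_space) chart set \<Rightarrow> 'm endo \<Rightarrow> 'm metric \<Rightarrow> bool" where
  "riemannian_almost_product M \<A> P g \<longleftrightarrow>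
     smooth_manifold M \<A> \<and> endo_field M \<A> P \<and> riemannian_metric M \<A> g \<and>
     (\<forall>x\<in>vector_fields M \<A>. eapply M P (eapply M P x) = x) \<and>
     (\<forall>x\<in>vector_fields M \<A>. \<forall>y\<in>vector_fields M \<A>. \<forall>p\<in>topspace M.
        metric_fun g (eapply M P x) (eapply M P y) p = metric_fun g x y p) \<and>
     (\<forall>p\<in>topspace M. trace_on (tangent_space \<A> p) (P p) = 0)"

text \<open>\<open>nablaP M D P x y\<close> is \<open>(\<nabla>\<^sub>x P) y\<close>.\<close>

definition nablaP ::
  "'m topology \<Rightarrow> 'm connection \<Rightarrow> 'm endo \<Rightarrow> 'm vfield \<Rightarrow> 'm vfield \<Rightarrow> 'm vfield" where
  "nablaP M D P x y = D x (eapply M P y) - eapply M P (D x y)"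

definition tensorF ::
  "'m topology \<Rightarrow> 'm endo \<Rightarrow> 'm metric \<Rightarrow> 'm connection \<Rightarrow>
   'm vfield \<Rightarrow> 'm vfield \<Rightarrow> 'm vfield \<Rightarrow> 'm \<Rightarrow> real" where
  "tensorF M P g D x y z = metric_fun g (nablaP M D P x y) z"

text \<open>The argument \<open>D\<close> is determined by \<open>g\<close>: it is the Levi-Civita connection.\<close>

definition riemannian_W3 ::
  "'m topology \<Rightarrow> ('m, 'e::euclidean_space) chart set \<Rightarrow> 'm endo \<Rightarrow> 'm metric \<Rightarrow>
   'm connection \<Rightarrow> bool" where
  "riemannian_W3 M \<A> P g D \<longleftrightarrow>
     riemannian_almost_product M \<A> P g \<and> levi_civita M \<A> g D \<and>
     (\<forall>x\<in>vector_fields M \<A>. \<forall>y\<in>vector_fields M \<A>. \<forall>z\<in>vector_fields M \<A>. \<forall>p\<in>topspace M.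
        tensorF M P g D x y z p + tensorF M P g D y z x p + tensorF M P g D z x y p = 0)"

definition tensorT ::
  "'m topology \<Rightarrow> 'm endo \<Rightarrow> 'm connection \<Rightarrow> 'm vfield \<Rightarrow> 'm vfield \<Rightarrow> 'm vfield" where
  "tensorT M P D x y = - nablaP M D P x (eapply M P y) - nablaP M D P y (eapply M P x)"

text \<open>\<open>nablaT M P D x y z\<close> is \<open>(\<nabla>\<^sub>x T)(y, z)\<close>.\<close>

definition nablaT ::
  "'m topology \<Rightarrow> 'm endo \<Rightarrow> 'm connection \<Rightarrow>
   'm vfield \<Rightarrow> 'm vfield \<Rightarrow> 'm vfield \<Rightarrow> 'm vfield" where
  "nablaT M P D x y z =
     D x (tensorT M P D y z) - tensorT M P D (D x y) z - tensorT M P D y (D x z)"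

definition tensorQ ::
  "'m topology \<Rightarrow> 'm endo \<Rightarrow> 'm connection \<Rightarrow>
   'm vfield \<Rightarrow> 'm vfield \<Rightarrow> 'm vfield \<Rightarrow> 'm vfield" where
  "tensorQ M P D x y z =
     nablaT M P D x y z - nablaT M P D y x z +
     tensorT M P D x (tensorT M P D y z) - tensorT M P D y (tensorT M P D x z)"

definition tensorL ::
  "'m topology \<Rightarrow> ('m, 'e::euclidean_space) chart set \<Rightarrow> 'm endo \<Rightarrow> 'm connection \<Rightarrow>
   'm vfield \<Rightarrow> 'm vfield \<Rightarrow> 'm vfield \<Rightarrow> 'm vfield" where
  "tensorL M \<A> P D x y z = curvature \<A> D x y z + vscale (\<lambda>_. 1 / 2) (tensorQ M P D x y z)"

end

theory Submission
  imports Defs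
begin

text \<open>
  Write \<open>\<nabla>\<^sup>2\<close> for the second covariant derivative of \<open>P\<close>. Expanding \<open>L = 0\<close> gives
  \<open>2R(x,y,z,w) = E(x,y,z,w) - E(y,x,z,w)\<close>, where up to terms quadratic in \<open>\<nabla>P\<close> one has
  \<open>E(x,y,z,w) = g((\<nabla>\<^sup>2\<^sub>x\<^sub>,\<^sub>y P)Pz, w) + g((\<nabla>\<^sup>2\<^sub>x\<^sub>,\<^sub>z P)Py, w)\<close>. The sum on the left-hand side of the
  theorem inserts \<open>P\<close> into an even number of the slots \<open>x, y, z\<close>, hence into an odd number of them on
  the right. By the derivative of the cyclic identity for \<open>F\<close>, the second derivatives become
  \<open>- g((\<nabla>\<^sup>2\<^sub>x\<^sub>,\<^sub>w P)y, z)\<close> summed over odd insertions, and differentiating \<open>P\<^sup>2 = 1\<close> twice turns this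
  into quadratic terms. These are matched with the help of the identity
  \<open>B(Pa,Pb) = - B(a,b)\<close> for \<open>B(a,b) = (\<nabla>\<^sub>aP)b + (\<nabla>\<^sub>bP)a\<close>.
\<close>

section \<open>Smoothness on open subsets of a Euclidean space\<close>

lemma frechet_derivative_cong_open:
  assumes "open S" "x \<in> S" "\<And>y. y \<in> S \<Longrightarrow> f y = h y"
  shows "frechet_derivative f (at x) = frechet_derivative h (at x)"
proof -
  have "(f has_derivative f') (at x) \<longleftrightarrow> (h has_derivative f') (at x)" for f'
  proof
    show "(h has_derivative f') (at x)" if "(f has_derivative f') (at x)"
      using that assms by (rule has_derivative_transform_within_open)
    show "(f has_derivative f') (at x)" if "(h has_derivative f') (at x)"
      using that assms(1,2) assms(3)[symmetric] by (rule has_derivative_transform_within_open)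
  qed
  then show ?thesis
    by (simp add: frechet_derivative_def)
qed

text \<open>On an open set derivatives depend only on the values there, so the induction passes from
  \<open>f\<close> and \<open>h\<close> to their directional derivatives.\<close>

lemma Ck_on_cong:
  assumes "open S" "\<And>y. y \<in> S \<Longrightarrow> f y = h y" "Ck_on k f S"
  shows "Ck_on k h S"
  using assms(2,3)
proof (induction k arbitrary: f h)
  case 0
  have "continuous_on S f" using 0(2) by simp
  then have "continuous_on S h" using 0(1) by (rule continuous_on_eq)
  then show ?case by simp
next
  case (Suc k)
  have "h differentiable (at x)" if x: "x \<in> S" for x
  proof -
    obtain f' where "(f has_derivative f') (at x)"
      using Suc.prems(2) x unfolding Ck_on.simps differentiable_def by blast
    then have "(h has_derivative f') (at x)"
      using assms(1) x Suc.prems(1) by (rule has_derivative_transform_within_open)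
    then show ?thesis unfolding differentiable_def by blast
  qed
  moreover have "Ck_on k (\<lambda>x. frechet_derivative h (at x) v) S" for v
  proof (rule Suc.IH)
    show "frechet_derivative f (at y) v = frechet_derivative h (at y) v" if "y \<in> S" for y
      by (rule fun_cong[OF frechet_derivative_cong_open[OF assms(1) that Suc.prems(1)]])
    show "Ck_on k (\<lambda>x. frechet_derivative f (at x) v) S"
      using Suc.prems(2) by simp
  qed
  ultimately show ?case by simp
qed

text \<open>Differences suffice as the basic closure property: negatives and sums are later written
  as iterated differences.\<close>

lemma Ck_on_diff:
  assumes "open S" "Ck_on k f S" "Ck_on k h S"
  shows "Ck_on k (\<lambda>x. f x - h x) S"
  using assms(2,3)
proof (induction k arbitrary: f h)
  case 0
  then show ?case unfolding Ck_on.simps by (rule continuous_on_diff)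
next
  case (Suc k)
  have "Ck_on k (\<lambda>x. frechet_derivative (\<lambda>x. f x - h x) (at x) v) S" for v
  proof (rule Ck_on_cong[OF assms(1)])
    show "Ck_on k (\<lambda>x. frechet_derivative f (at x) v - frechet_derivative h (at x) v) S"
      using Suc.prems by (intro Suc.IH) simp_all
    show "frechet_derivative f (at y) v - frechet_derivative h (at y) v
        = frechet_derivative (\<lambda>x. f x - h x) (at y) v" if "y \<in> S" for y
    proof -
      have "((\<lambda>x. f x - h x) has_derivative
          (\<lambda>v. frechet_derivative f (at y) v - frechet_derivative h (at y) v)) (at y)"
        using Suc.prems that by (intro has_derivative_diff frechet_derivative_works[THEN iffD1]) simp_all
      from fun_cong[OF frechet_derivative_at[OF this]] show ?thesis .
    qed
  qed
  then show ?case
    using Suc.prems unfolding Ck_on.simps by (blast intro: differentiable_diff)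
qed

section \<open>Smooth functions, tangent vectors and vector fields\<close>

locale manifold =
  fixes M :: "'m topology" and \<A> :: "('m, 'e::euclidean_space) chart set"
  assumes manifold: "smooth_manifold M \<A>"
begin

lemma chartD:
  assumes "(U, \<phi>) \<in> \<A>"
  shows "open (\<phi> ` U)" "U \<subseteq> topspace M"
  using manifold assms unfolding smooth_manifold_def is_chart_def by (auto dest!: openin_subset)

lemma smooth_fun_diff:
  assumes "smooth_fun \<A> f" "smooth_fun \<A> h"
  shows "smooth_fun \<A> (f - h)"
  unfolding smooth_fun_def
proof clarify
  fix U \<phi> assume c: "(U, \<phi>) \<in> \<A>"
  have "(f - h) \<circ> inv_into U \<phi> = (\<lambda>x. (f \<circ> inv_into U \<phi>) x - (h \<circ> inv_into U \<phi>) x)"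
    by (simp add: fun_eq_iff)
  then show "smooth_on ((f - h) \<circ> inv_into U \<phi>) (\<phi> ` U)"
    using assms c chartD(1)[OF c] Ck_on_diff unfolding smooth_fun_def smooth_on_def by fastforce
qed

text \<open>Smoothness is tested in charts, whose domains lie in the manifold. This matters because
  identities for the metric are only available on \<open>topspace M\<close>.\<close>

lemma smooth_fun_cong:
  assumes "smooth_fun \<A> f" "\<And>q. q \<in> topspace M \<Longrightarrow> f q = h q"
  shows "smooth_fun \<A> h"
  unfolding smooth_fun_def
proof clarify
  fix U \<phi> assume c: "(U, \<phi>) \<in> \<A>"
  have "f (inv_into U \<phi> y) = h (inv_into U \<phi> y)" if "y \<in> \<phi> ` U" for y
    using that chartD[OF c] by (intro assms) (meson inv_into_into subsetD)
  then show "smooth_on (h \<circ> inv_into U \<phi>) (\<phi> ` U)"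
    using assms(1) c chartD(1)[OF c]
      Ck_on_cong[of "\<phi> ` U" "f \<circ> inv_into U \<phi>" "h \<circ> inv_into U \<phi>"]
    unfolding smooth_fun_def smooth_on_def comp_def by blast
qed

lemma smooth_fun_minus:
  assumes "smooth_fun \<A> f" shows "smooth_fun \<A> (- f)"
  using smooth_fun_diff[OF smooth_fun_diff[OF assms assms] assms] by simp

lemma smooth_fun_add:
  assumes "smooth_fun \<A> f" "smooth_fun \<A> h" shows "smooth_fun \<A> (f + h)"
  using smooth_fun_diff[OF assms(1) smooth_fun_minus[OF assms(2)]] by simp

lemma tangent_add:
  assumes "v \<in> tangent_space \<A> p" "smooth_fun \<A> f" "smooth_fun \<A> h"
  shows "v (f + h) = v f + v h"
  using assms by (simp add: tangent_space_def)

lemma tangent_diff: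
  assumes "v \<in> tangent_space \<A> p" "smooth_fun \<A> f" "smooth_fun \<A> h"
  shows "v (f - h) = v f - v h"
  using tangent_add[OF assms(1) smooth_fun_diff[OF assms(2,3)] assms(3)] by simp

text \<open>A smooth function vanishing on the manifold is its own product with the indicator of the
  complement, so the Leibniz rule kills it.\<close>

lemma tangent_cong:
  assumes "v \<in> tangent_space \<A> p" "p \<in> topspace M" "smooth_fun \<A> f"
    and eq: "\<And>q. q \<in> topspace M \<Longrightarrow> f q = h q"
  shows "v f = v h"
proof -
  have h: "smooth_fun \<A> h" using smooth_fun_cong[OF assms(3) eq] .
  define k where "k = f - h"
  define j :: "'m \<Rightarrow> real" where "j q = (if q \<in> topspace M then 0 else 1)" for q
  have k: "smooth_fun \<A> k" unfolding k_def by (rule smooth_fun_diff[OF assms(3) h])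
  have k0: "k q = 0" if "q \<in> topspace M" for q using eq[OF that] by (simp add: k_def)
  have j: "smooth_fun \<A> j" by (rule smooth_fun_cong[OF k]) (simp add: j_def k0)
  have "k = k * j" by (auto simp: fun_eq_iff j_def k0)
  then have "v k = v (k * j)" by simp
  also have "\<dots> = k p * v j + j p * v k"
    using assms(1) k j unfolding tangent_space_def by blast
  also have "\<dots> = 0" using assms(2) by (simp add: k0 j_def)
  finally show ?thesis using tangent_diff[OF assms(1,3) h] by (simp add: k_def)
qed

lemma tangent_space_diff:
  assumes "u \<in> tangent_space \<A> p" "v \<in> tangent_space \<A> p"
  shows "u - v \<in> tangent_space \<A> p"
  using assms by (auto simp: tangent_space_def algebra_simps)

lemma vector_fieldD:
  assumes "X \<in> vector_fields M \<A>" "p \<in> topspace M"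
  shows "X p \<in> tangent_space \<A> p"
  using assms by (simp add: vector_fields_def)

lemma vector_fields_diff:
  assumes "X \<in> vector_fields M \<A>" "Y \<in> vector_fields M \<A>"
  shows "X - Y \<in> vector_fields M \<A>"
proof -
  have "vapply (X - Y) f = vapply X f - vapply Y f" for f
    by (simp add: vapply_def fun_eq_iff)
  then show ?thesis
    using assms by (auto simp: vector_fields_def tangent_space_diff smooth_fun_diff)
qed

lemma vector_fields_zero: "0 \<in> vector_fields M \<A>" if "X \<in> vector_fields M \<A>"
  using vector_fields_diff[OF that that] by simp

lemma vector_fields_minus:
  assumes "X \<in> vector_fields M \<A>" shows "- X \<in> vector_fields M \<A>"
  using vector_fields_diff[OF vector_fields_zero[OF assms] assms] by simp

lemma vector_fields_add:
  assumes "X \<in> vector_fields M \<A>" "Y \<in> vector_fields M \<A>"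
  shows "X + Y \<in> vector_fields M \<A>"
  using vector_fields_diff[OF assms(1) vector_fields_minus[OF assms(2)]] by simp

end

section \<open>The connection, \<open>P\<close> and the derivatives of \<open>P\<close>\<close>

locale W3_manifold =
  fixes M :: "'m topology" and \<A> :: "('m, 'e::euclidean_space) chart set"
    and P :: "'m endo" and g :: "'m metric" and D :: "'m connection"
  assumes W3: "riemannian_W3 M \<A> P g D"
begin

abbreviation VF where "VF \<equiv> vector_fields M \<A>"
abbreviation J where "J \<equiv> eapply M P"
abbreviation N where "N \<equiv> nablaP M D P"
abbreviation ip where "ip \<equiv> metric_fun g"
abbreviation T where "T \<equiv> tensorT M P D"

lemma almost_product: "riemannian_almost_product M \<A> P g"
  and levi_civita: "levi_civita M \<A> g D"
  using W3 by (auto simp: riemannian_W3_def)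

sublocale manifold M \<A>
  using almost_product by unfold_locales (simp add: riemannian_almost_product_def)

lemma connection: "affine_connection M \<A> D"
  using levi_civita by (simp add: levi_civita_def)

lemma D_in: "X \<in> VF \<Longrightarrow> Y \<in> VF \<Longrightarrow> D X Y \<in> VF"
  using connection by (simp add: affine_connection_def)

lemma D_add:
  assumes "X \<in> VF" "Y \<in> VF" "Z \<in> VF"
  shows "D (X + Y) Z = D X Z + D Y Z" "D X (Y + Z) = D X Y + D X Z"
  using connection assms by (simp_all add: affine_connection_def)

lemma D_diff:
  assumes "X \<in> VF" "Y \<in> VF" "Z \<in> VF"
  shows "D (X - Y) Z = D X Z - D Y Z" "D X (Y - Z) = D X Y - D X Z"
  using D_add(1)[of "X - Y" Y Z] D_add(2)[of X "Y - Z" Z] assms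
  by (simp_all add: vector_fields_diff)

lemma D_minus:
  assumes "X \<in> VF" "Y \<in> VF"
  shows "D X (- Y) = - D X Y"
  using D_diff(2)[of X 0 Y] D_diff(2)[of X Y Y] vector_fields_zero[of Y] assms by simp

lemma endo: "endo_field M \<A> P"
  and metric: "riemannian_metric M \<A> g"
  using almost_product by (auto simp: riemannian_almost_product_def)

lemma J_in: "X \<in> VF \<Longrightarrow> J X \<in> VF"
  using endo by (simp add: endo_field_def)

lemma J_add: "X \<in> VF \<Longrightarrow> Y \<in> VF \<Longrightarrow> J (X + Y) = J X + J Y"
  using endo by (auto simp: endo_field_def eapply_def fun_eq_iff vector_fieldD)

lemma J_diff: "X \<in> VF \<Longrightarrow> Y \<in> VF \<Longrightarrow> J (X - Y) = J X - J Y"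
  using J_add[of "X - Y" Y] by (simp add: vector_fields_diff)

lemma J_J: "X \<in> VF \<Longrightarrow> J (J X) = X"
  using almost_product by (simp add: riemannian_almost_product_def)

lemma N_in: "X \<in> VF \<Longrightarrow> Y \<in> VF \<Longrightarrow> N X Y \<in> VF"
  by (simp add: nablaP_def D_in J_in vector_fields_diff)

lemmas closed = D_in J_in N_in vector_fields_add vector_fields_diff vector_fields_minus

lemma N_add:
  assumes "X \<in> VF" "Y \<in> VF" "Z \<in> VF"
  shows "N X (Y + Z) = N X Y + N X Z"
  using assms by (simp add: nablaP_def D_add J_add closed)

text \<open>Differentiating \<open>P\<^sup>2 = 1\<close> once shows that the covariant derivative of
  \<open>P\<close> anticommutes with \<open>P\<close>.\<close>

lemma N_J: "X \<in> VF \<Longrightarrow> Y \<in> VF \<Longrightarrow> N X (J Y) = - J (N X Y)"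
  by (simp add: nablaP_def J_diff J_J closed)

lemma J_minus: "X \<in> VF \<Longrightarrow> J (- X) = - J X"
  using J_diff[of 0 X] J_diff[of X X] vector_fields_zero[of X] by simp

text \<open>The second covariant derivative
  \<open>(\<nabla>\<^sup>2\<^sub>u\<^sub>,\<^sub>x P)y\<close>, that is, \<open>\<nabla>P\<close>
  differentiated as a tensor.\<close>

definition N2 where "N2 u x y = D u (N x y) - N (D u x) y - N x (D u y)"

lemma N2_in: "u \<in> VF \<Longrightarrow> x \<in> VF \<Longrightarrow> y \<in> VF \<Longrightarrow> N2 u x y \<in> VF"
  by (simp add: N2_def closed)

lemma D_J: "X \<in> VF \<Longrightarrow> Y \<in> VF \<Longrightarrow> D X (J Y) = N X Y + J (D X Y)"
  by (simp add: nablaP_def)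

text \<open>The second derivative of \<open>P\<^sup>2 = 1\<close>; it trades second-order terms for
  quadratic ones.\<close>

lemma N2_J:
  assumes "u \<in> VF" "x \<in> VF" "y \<in> VF"
  shows "N2 u x (J y) + J (N2 u x y) + N u (N x y) + N x (N u y) = 0"
  using assms by (simp add: N2_def N_J D_J D_minus J_diff N_add closed)

text \<open>Since \<open>T\<close> contains \<open>P\<close> inside the argument of
  \<open>N\<close>, the product rule yields quadratic terms besides \<open>N2\<close>.\<close>

lemma nablaT_eq:
  assumes "x \<in> VF" "y \<in> VF" "z \<in> VF"
  shows "nablaT M P D x y z
    = - N2 x y (J z) - N y (N x z) - N2 x z (J y) - N z (N x y)"
  using assms by (simp add: nablaT_def tensorT_def N2_def D_J D_minus D_diff N_add closed)

lemma T_in: "x \<in> VF \<Longrightarrow> y \<in> VF \<Longrightarrow> T x y \<in> VF"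
  by (simp add: tensorT_def closed)

section \<open>Metric identities for \<open>P\<close>, \<open>N\<close>, \<open>N2\<close> and
  \<open>T\<close>\<close>

lemma ip_smooth: "x \<in> VF \<Longrightarrow> y \<in> VF \<Longrightarrow> smooth_fun \<A> (ip x y)"
  using metric by (simp add: riemannian_metric_def)

lemma metric_sym:
  "p \<in> topspace M \<Longrightarrow> \<forall>u\<in>tangent_space \<A> p. \<forall>v\<in>tangent_space \<A> p. g p u v = g p v u"
  and metric_add: "p \<in> topspace M \<Longrightarrow> \<forall>u\<in>tangent_space \<A> p. \<forall>v\<in>tangent_space \<A> p.
    \<forall>w\<in>tangent_space \<A> p. g p (u + v) w = g p u w + g p v w"
  using metric[unfolded riemannian_metric_def, THEN conjunct1, THEN bspec, of p]
  by (iprover elim: conjE)+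

lemma ip_sym: "p \<in> topspace M \<Longrightarrow> x \<in> VF \<Longrightarrow> y \<in> VF \<Longrightarrow> ip x y p = ip y x p"
  using metric_sym[THEN bspec, THEN bspec, of p "x p" "y p"]
  by (simp add: metric_fun_def vector_fieldD)

lemma ip_add:
  "\<lbrakk>p \<in> topspace M; x \<in> VF; y \<in> VF; z \<in> VF\<rbrakk> \<Longrightarrow> ip (x + y) z p = ip x z p + ip y z p"
  using metric_add[THEN bspec, THEN bspec, THEN bspec, of p "x p" "y p" "z p"]
  by (simp add: metric_fun_def vector_fieldD)

lemma ip_diff: "\<lbrakk>p \<in> topspace M; x \<in> VF; y \<in> VF; z \<in> VF\<rbrakk> \<Longrightarrow> ip (x - y) z p = ip x z p - ip y z p"
  using ip_add[of p "x - y" y z] by (simp add: closed)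

lemma ip_zero: "p \<in> topspace M \<Longrightarrow> z \<in> VF \<Longrightarrow> ip 0 z p = 0"
  using ip_diff[of p z z z] by simp

lemma ip_minus: "p \<in> topspace M \<Longrightarrow> x \<in> VF \<Longrightarrow> z \<in> VF \<Longrightarrow> ip (- x) z p = - ip x z p"
  using ip_diff[of p 0 x z] vector_fields_zero[of z] by (simp add: ip_zero)

lemma ip_add2: "\<lbrakk>p \<in> topspace M; x \<in> VF; y \<in> VF; z \<in> VF\<rbrakk> \<Longrightarrow> ip z (x + y) p = ip z x p + ip z y p"
  by (simp add: ip_sym[of p z] ip_add closed)

lemma ip_diff2: "\<lbrakk>p \<in> topspace M; x \<in> VF; y \<in> VF; z \<in> VF\<rbrakk> \<Longrightarrow> ip z (x - y) p = ip z x p - ip z y p"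
  by (simp add: ip_sym[of p z] ip_diff closed)

lemma ip_minus2: "p \<in> topspace M \<Longrightarrow> x \<in> VF \<Longrightarrow> z \<in> VF \<Longrightarrow> ip z (- x) p = - ip z x p"
  by (simp add: ip_sym[of p z] ip_minus closed)

lemma ip_J_J: "\<forall>x\<in>VF. \<forall>y\<in>VF. \<forall>p\<in>topspace M. ip (J x) (J y) p = ip x y p"
  using almost_product[unfolded riemannian_almost_product_def] by (iprover elim: conjE)

text \<open>An isometric involution is self-adjoint.\<close>

lemma ip_J: "p \<in> topspace M \<Longrightarrow> x \<in> VF \<Longrightarrow> y \<in> VF \<Longrightarrow> ip (J x) y p = ip x (J y) p"
  using ip_J_J[THEN bspec, THEN bspec, THEN bspec, of x "J y" p] by (simp add: J_J J_in)

lemma ip_deriv: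
  assumes "p \<in> topspace M" "u \<in> VF" "x \<in> VF" "y \<in> VF"
  shows "u p (ip x y) = ip (D u x) y p + ip x (D u y) p"
  using levi_civita[unfolded levi_civita_def, THEN conjunct2, THEN bspec, THEN bspec,
      THEN conjunct2, THEN bspec, THEN bspec, OF assms(2,3,4,1)]
  by (simp add: vapply_def)

lemmas ip_simps = ip_add ip_diff ip_minus
  ip_add2 ip_diff2 ip_minus2

lemma N_ip:
  assumes p: "p \<in> topspace M" and "x \<in> VF" "y \<in> VF" "z \<in> VF"
  shows "ip (N x y) z p = ip (N x z) y p"
proof -
  have J: "ip (J a) b q = ip (J b) a q" if "q \<in> topspace M" "a \<in> VF" "b \<in> VF" for a b q
    using ip_J[OF that] ip_sym[of q a "J b"] that by (simp add: closed)
  have "x p (ip (J y) z) = x p (ip (J z) y)"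
  \<comment> \<open>Self-adjointness of \<open>P\<close> is differentiated along \<open>x\<close>.
    The two functions are only known to agree on the manifold, hence
    \<open>tangent_cong\<close>.\<close>
  proof (rule tangent_cong[OF vector_fieldD[OF assms(2,1)] p])
    show "smooth_fun \<A> (ip (J y) z)"
      using assms by (simp add: ip_smooth closed)
  qed (use assms J in blast)
  then have "ip (D x (J y)) z p + ip (J y) (D x z) p = ip (D x (J z)) y p + ip (J z) (D x y) p"
    using assms by (simp add: ip_deriv closed)
  moreover have "ip (J y) (D x z) p = ip (J (D x z)) y p" "ip (J z) (D x y) p = ip (J (D x y)) z p"
    using assms by (intro J D_in; simp)+
  ultimately show ?thesis
    using assms by (simp add: nablaP_def ip_simps closed)
qed

lemma N_cyclic:
  assumes p: "p \<in> topspace M" and "x \<in> VF" "y \<in> VF" "z \<in> VF"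
  shows "ip (N x y) z p + ip (N y z) x p + ip (N z x) y p = 0"
  using W3 assms unfolding riemannian_W3_def tensorF_def by blast

text \<open>Reduces \<open>N2\<close> to derivatives of scalar functions. A linear identity for
  \<open>N\<close> then passes to \<open>N2\<close>, the correction terms being further instances of
  that identity.\<close>

lemma N2_ip:
  assumes p: "p \<in> topspace M" and "u \<in> VF" "x \<in> VF" "y \<in> VF" "z \<in> VF"
  shows "ip (N2 u x y) z p = u p (ip (N x y) z)
    - ip (N (D u x) y) z p - ip (N x (D u y)) z p - ip (N x y) (D u z) p"
  using assms by (simp add: N2_def ip_deriv ip_simps closed)

lemma N2_sym:
  assumes p: "p \<in> topspace M" and "u \<in> VF" "x \<in> VF" "y \<in> VF" "z \<in> VF"
  shows "ip (N2 u x y) z p = ip (N2 u x z) y p"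
proof -
  have "u p (ip (N x y) z) = u p (ip (N x z) y)"
  proof (rule tangent_cong[OF vector_fieldD[OF assms(2,1)] p])
    show "smooth_fun \<A> (ip (N x y) z)"
      using assms by (simp add: ip_smooth closed)
  qed (use assms N_ip in blast)
  then show ?thesis
    using assms N_ip[of p "D u x" y z] N_ip[of p x "D u y" z] N_ip[of p x y "D u z"]
    by (simp add: N2_ip closed)
qed

lemma N2_cyclic:
  assumes p: "p \<in> topspace M" and "u \<in> VF" "x \<in> VF" "y \<in> VF" "z \<in> VF"
  shows "ip (N2 u x y) z p + ip (N2 u y z) x p + ip (N2 u z x) y p = 0"
proof -
  have u: "u p \<in> tangent_space \<A> p" using assms by (simp add: vector_fieldD)
  have s: "smooth_fun \<A> (ip (N x y) z)" "smooth_fun \<A> (ip (N y z) x)" "smooth_fun \<A> (ip (N z x) y)"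
    using assms by (simp_all add: ip_smooth closed)
  \<comment> \<open>\<open>ip x x - ip x x\<close> serves as a zero function already known to be a
    difference of smooth functions, so \<open>u\<close> kills it by
    \<open>tangent_diff\<close>.\<close>
  have "u p (ip (N x y) z + ip (N y z) x + ip (N z x) y) = u p (ip x x - ip x x)"
  proof (rule tangent_cong[OF u p])
    show "smooth_fun \<A> (ip (N x y) z + ip (N y z) x + ip (N z x) y)"
      using s by (simp add: smooth_fun_add)
  qed (use assms N_cyclic in simp)
  moreover have "u p (ip x x - ip x x) = 0"
    using assms by (subst tangent_diff[OF u]) (simp_all add: ip_smooth)
  ultimately have "u p (ip (N x y) z) + u p (ip (N y z) x) + u p (ip (N z x) y) = 0"
    using s by (simp add: tangent_add[OF u] smooth_fun_add)
  then show ?thesis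
    using assms N_cyclic[of p "D u x" y z] N_cyclic[of p x "D u y" z]
      N_cyclic[of p x y "D u z"]
    by (simp add: N2_ip closed)
qed

lemma N2_J_ip:
  assumes p: "p \<in> topspace M" and "u \<in> VF" "x \<in> VF" "y \<in> VF" "z \<in> VF"
  shows "ip (N2 u x (J y)) z p + ip (N2 u x y) (J z) p
    + ip (N u z) (N x y) p + ip (N x z) (N u y) p = 0"
proof -
  have "ip (N2 u x (J y) + J (N2 u x y) + N u (N x y) + N x (N u y)) z p = 0"
    using assms by (simp add: N2_J ip_zero)
  then show ?thesis
    using assms N_ip[of p u "N x y" z] N_ip[of p x "N u y" z]
    by (simp add: ip_simps ip_J N2_in closed)
qed

text \<open>Computes the metric adjoint of \<open>T x\<close>. The cyclic identity moves
  \<open>e\<close> out of the direction of differentiation, so that \<open>e\<close> can later be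
  replaced by \<open>T y z\<close>.\<close>

lemma T_ip:
  assumes p: "p \<in> topspace M" and "x \<in> VF" "e \<in> VF" "w \<in> VF"
  shows "ip (T x e) w p = ip e (N x (J w) + N (J x) w + N w (J x)) p"
  using assms N_ip[of p x "J e" w] N_cyclic[of p e "J x" w]
    N_ip[of p w e "J x"] N_ip[of p "J x" e w]
    ip_sym[of p e "N (J x) w"] ip_sym[of p e "N w (J x)"]
    ip_sym[of p "N x w" "J e"] ip_J[of p e "N x w"]
  by (simp add: tensorT_def ip_simps N_J[of x w] closed)

text \<open>With \<open>B(a,b) = N a b + N b a\<close>, the cyclic identity gives
  \<open>g(B(a,b), e) = - g(N e a, b)\<close>. The right-hand side changes sign when
  \<open>P\<close> is applied to both \<open>a\<close> and \<open>b\<close>, because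
  \<open>N e\<close> anticommutes with the isometry \<open>P\<close>.\<close>

lemma N_pair:
  assumes p: "p \<in> topspace M" and "a \<in> VF" "b \<in> VF" "e \<in> VF"
  shows "ip (N a b) e p + ip (N b a) e p + ip (N (J a) (J b)) e p + ip (N (J b) (J a)) e p = 0"
proof -
  have *: "ip (N a b) e p + ip (N b a) e p + ip (N e a) b p = 0"
    if "a \<in> VF" "b \<in> VF" for a b
    using N_cyclic[OF p that assms(4)] N_ip[OF p that(2) assms(4) that(1)] by simp
  have "ip (N e (J a)) (J b) p = - ip (N e a) b p"
    using assms by (simp add: N_J ip_minus ip_J J_J closed)
  then show ?thesis
    using *[of a b] *[of "J a" "J b"] assms by (simp add: J_in)
qed

lemma N2_odd:
  assumes p: "p \<in> topspace M" and u: "u \<in> VF" and v: "v \<in> VF" and z: "z \<in> VF" and w: "w \<in> VF"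
  shows "ip (N2 (J u) v z) w p + ip (N2 (J u) z v) w p
      + ip (N2 u (J v) z) w p + ip (N2 u z (J v)) w p
      + ip (N2 u v (J z)) w p + ip (N2 u (J z) v) w p
      + ip (N2 (J u) (J v) (J z)) w p + ip (N2 (J u) (J z) (J v)) w p
    = ip (N u z) (N w v) p + ip (N w z) (N u v) p
      + ip (N (J u) (J z)) (N w v) p + ip (N w (J z)) (N (J u) v) p"
proof -
  \<comment> \<open>Each symmetrised pair becomes one term with \<open>w\<close> as direction,
    leaving four second-order terms.\<close>
  have cyc: "ip (N2 a b c) w p + ip (N2 a c b) w p = - ip (N2 a w b) c p"
    if "a \<in> VF" "b \<in> VF" "c \<in> VF" for a b c
    using N2_cyclic[OF p that w] N2_sym[OF p that(1,3,2) w] by linarith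
  note vf = u v z w J_in[OF u] J_in[OF v] J_in[OF z]
  show ?thesis
    \<comment> \<open>The four terms cancel in two pairs, one with first slot \<open>u\<close> and
      one with \<open>J u\<close>, up to the quadratic terms of \<open>N2_J_ip\<close>.\<close>
    using cyc[of "J u" v z] cyc[of u "J v" z] cyc[of u v "J z"] cyc[of "J u" "J v" "J z"]
      N2_J_ip[OF p u w v z] N2_J_ip[OF p vf(5) w v vf(7)] vf by (simp add: J_J)
qed

text \<open>Minus the part of \<open>g(Q(x,y)z, w)\<close> that is not antisymmetrised in
  \<open>x\<close>, \<open>y\<close>. The first two lines come from \<open>\<nabla>T\<close>, the
  last two from \<open>T x (T y z)\<close> via \<open>T_ip\<close>.\<close>

definition E where
  "E p x y z w = ip (N2 x y (J z)) w p + ip (N y w) (N x z) p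
    + ip (N2 x z (J y)) w p + ip (N z w) (N x y) p
    + ip (N y (J z)) (N x (J w)) p + ip (N y (J z)) (N (J x) w) p + ip (N y (J z)) (N w (J x)) p
    + ip (N z (J y)) (N x (J w)) p + ip (N z (J y)) (N (J x) w) p + ip (N z (J y)) (N w (J x)) p"

lemma E_eq:
  assumes p: "p \<in> topspace M" and "x \<in> VF" "y \<in> VF" "z \<in> VF" "w \<in> VF"
  shows "ip (nablaT M P D x y z) w p + ip (T x (T y z)) w p = - E p x y z w"
proof -
  have "ip (N y (N x z)) w p = ip (N y w) (N x z) p" "ip (N z (N x y)) w p = ip (N z w) (N x y) p"
    using assms by (simp_all add: N_ip closed)
  moreover have "ip (T x (T y z)) w p = ip (T y z) (N x (J w) + N (J x) w + N w (J x)) p"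
    using assms by (simp add: T_ip T_in)
  ultimately show ?thesis
    using assms by (simp add: nablaT_eq E_def tensorT_def ip_simps N2_in closed)
qed

lemma lie_bracket_eq:
  assumes "x \<in> VF" "y \<in> VF"
  shows "lie_bracket \<A> x y = D x y - D y x"
  using levi_civita[unfolded levi_civita_def, THEN conjunct2, THEN bspec, THEN bspec,
      THEN conjunct1, OF assms] by simp

lemma curvature_in:
  assumes "x \<in> VF" "y \<in> VF" "z \<in> VF"
  shows "curvature \<A> D x y z \<in> VF"
  using assms by (simp add: curvature_def lie_bracket_eq closed)

lemma nablaT_in:
  assumes "x \<in> VF" "y \<in> VF" "z \<in> VF"
  shows "nablaT M P D x y z \<in> VF"
  using assms by (simp add: nablaT_def T_in closed)

end

section \<open>The curvature identity when \<open>L\<close> vanishes\<close>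

locale W3_L0_manifold = W3_manifold M \<A> P g D
  for M :: "'m topology" and \<A> :: "('m, 'e::euclidean_space) chart set"
    and P :: "'m endo" and g :: "'m metric" and D :: "'m connection" +
  assumes L0: "\<And>a b c. a \<in> VF \<Longrightarrow> b \<in> VF \<Longrightarrow> c \<in> VF \<Longrightarrow> tensorL M \<A> P D a b c = 0"
begin

abbreviation R where "R \<equiv> curvature4 \<A> g D"

lemma L_ip:
  assumes p: "p \<in> topspace M" and "x \<in> VF" "y \<in> VF" "z \<in> VF" "w \<in> VF"
  shows "2 * R x y z w p = E p x y z w - E p y x z w"
proof -
  let ?C = "curvature \<A> D x y z" and ?Q = "tensorQ M P D x y z"
  have C: "?C \<in> VF" using assms by (simp add: curvature_in)
  have "?Q q f + 2 * ?C q f = 0" for q f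
    using fun_cong[OF fun_cong[OF L0[of x y z]], of q f] assms
    by (simp add: tensorL_def vscale_def tscale_def)
  \<comment> \<open>Clearing the factor one half turns scaling into a sum, so additivity of the
    metric is enough.\<close>
  then have "?Q = - (?C + ?C)" by (simp add: fun_eq_iff eq_neg_iff_add_eq_0)
  then have "ip ?Q w p = - ip (?C + ?C) w p"
    using ip_minus[OF p vector_fields_add[OF C C] assms(5)] by simp
  also have "\<dots> = - 2 * R x y z w p"
    unfolding ip_add[OF p C C assms(5)] curvature4_def by simp
  finally have "ip ?Q w p = - 2 * R x y z w p" .
  moreover have "ip ?Q w p = - E p x y z w + E p y x z w"
    using assms E_eq[OF p, of x y z w] E_eq[OF p, of y x z w]
    by (simp add: tensorQ_def ip_simps nablaT_in T_in closed)
  ultimately show ?thesis by simp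
qed

lemma curvature_identity:
  assumes p: "p \<in> topspace M" and x: "x \<in> VF" and y: "y \<in> VF" and z: "z \<in> VF" and w: "w \<in> VF"
  shows "2 * (R x y z w p + R x (J y) (J z) w p + R (J x) (J y) z w p + R (J x) y (J z) w p)
       = 2 * ip (N y (J x) + N (J y) x) (N (J w) z) p
         + ip (N y (J z) + N (J y) z) (N (J w) x) p
         + ip (N z (J x) + N (J z) x) (N (J w) y) p"
proof -
  note vf = x y z w J_in[OF x] J_in[OF y] J_in[OF z] J_in[OF w]
  have swap: "ip (N c d) (N a b) p = ip (N a b) (N c d) p"
    "ip (N c d) (J (N a b)) p = ip (N a b) (J (N c d)) p"
    if "a \<in> VF" "b \<in> VF" "c \<in> VF" "d \<in> VF" for a b c d
    using ip_sym[OF p, of "N c d" "N a b"] ip_sym[OF p, of "N c d" "J (N a b)"]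
      ip_J[OF p, of "N a b" "N c d"] that by (simp_all add: closed)
  \<comment> \<open>Every quadratic term is brought to the form \<open>g((\<nabla>\<^sub>aP)b, (\<nabla>\<^sub>cP)d)\<close> or \<open>g((\<nabla>\<^sub>aP)b, P(\<nabla>\<^sub>cP)d)\<close>,
    with \<open>b\<close>, \<open>d\<close> free of \<open>P\<close> and \<open>x\<close> occurring in the first factor.\<close>
  note norm = True_implies_equals p vf vector_fields_minus N_in J_in N2_in
    J_J N_J J_minus minus_minus ip_minus ip_minus2 ip_add ip_J
    swap[of x] swap[of "J x"] swap[of _ x]
  note curv = L_ip[OF p, of x y z w]
    L_ip[OF p, of x "J y" "J z" w]
    L_ip[OF p, of "J x" "J y" z w]
    L_ip[OF p, of "J x" y "J z" w]
  \<comment> \<open>The two instances cover the second-order terms of the four \<open>E\<close> with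
    \<open>x\<close> first and of the four subtracted ones with \<open>y\<close> first,
    respectively.\<close>
  note N2 = N2_odd[OF p x y z w] N2_odd[OF p y x z w]
  \<comment> \<open>Each instance pairs \<open>B\<close> of two of the four fields with
    \<open>N\<close> of the other two, up to insertions of \<open>P\<close>. These are the linear
    relations among the remaining quadratic terms.\<close>
  note pair = N_pair[OF p, of z w "N y x"]
    N_pair[OF p, of x w "N (J y) (J z)"]
    N_pair[OF p, of z w "N (J y) (J x)"]
    N_pair[OF p, of x w "N y z"]
    N_pair[OF p, of y w "N (J z) (J x)"]
    N_pair[OF p, of x z "N (J y) (J w)"]
    N_pair[OF p, of y z "N (J w) (J x)"]
    N_pair[OF p, of x w "N (J z) (J y)"]
    N_pair[OF p, of x w "N z y"]
    N_pair[OF p, of z w "N (J x) (J y)"]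
    N_pair[OF p, of x y "N (J w) (J z)"]
    N_pair[OF p, of x z "N w y"]
    N_pair[OF p, of y w "N z x"]
    N_pair[OF p, of z w "N x y"]
    N_pair[OF p, of x z "N y w"]
  show ?thesis
    \<comment> \<open>In normal form the goal follows from the listed facts by linear combination.
      \<open>True_implies_equals\<close> strips the membership premises once they have simplified to
      \<open>True\<close>.\<close>
    by (simp only: norm)
      (use curv[unfolded E_def, simplified norm] N2[simplified norm] pair[simplified norm] in algebra)
qed

end

theorem theorem5p3:
  fixes M :: "'m topology" and \<A> :: "('m, 'e::euclidean_space) chart set"
    and P :: "'m endo" and g :: "'m metric" and D :: "'m connection"
    and x y z w :: "'m vfield"
  defines "P' \<equiv> eapply M P" and "R \<equiv> curvature4 \<A> g D" and "dP \<equiv> nablaP M D P"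
  assumes "riemannian_W3 M \<A> P g D"
    and "\<And>a b c. a \<in> vector_fields M \<A> \<Longrightarrow> b \<in> vector_fields M \<A> \<Longrightarrow> c \<in> vector_fields M \<A>
           \<Longrightarrow> tensorL M \<A> P D a b c = 0"
    and "x \<in> vector_fields M \<A>" and "y \<in> vector_fields M \<A>"
    and "z \<in> vector_fields M \<A>" and "w \<in> vector_fields M \<A>"
    and "p \<in> topspace M"
  shows "2 * (R x y z w p + R x (P' y) (P' z) w p + R (P' x) (P' y) z w p + R (P' x) y (P' z) w p)
       = 2 * metric_fun g (dP y (P' x) + dP (P' y) x) (dP (P' w) z) p
         + metric_fun g (dP y (P' z) + dP (P' y) z) (dP (P' w) x) p
         + metric_fun g (dP z (P' x) + dP (P' z) x) (dP (P' w) y) p"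
proof -
  interpret W3_L0_manifold M \<A> P g D
    using assms(4,5) by unfold_locales auto
  show ?thesis
    unfolding P'_def R_def dP_def using assms(6-) by (intro curvature_identity)
qed

end
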